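(* As $x \to \infty$, $$f(x) > \frac{x}{L(\sqrt{2} + o(1), x)}.$$
   Context: For real $c$ and large $x$, $L(c,x) := \exp\left(c\sqrt{\log x \log\log x}\right)$. The arithmetic progression $a \pmod{q}$ is the residue class $\{n \in \mathbb{Z} : n \equiv a \pmod q\}$. A collection $a_1 \pmod{q_1}, \ldots, a_k \pmod{q_k}$ is called disjoint (non-intersecting) if $\{a_i \pmod{q_i}\} \cap \{a_j \pmod{q_j}\} = \emptyset$ whenever $i \neq j$. $f(x)$ denotes the maximum value of $k$ for which there exist integers $2 \leq q_1 < q_2 < \cdots < q_k \leq x$ and integers $a_1, \ldots, a_k$ such that the progressions $a_1 \pmod{q_1}, \ldots, a_k \pmod{q_k}$ are disjoint. The term $o(1)$ denotes a quantity depending on $x$ that tends to $0$ as $x \to \infty$. *)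

theory Defs
  imports Complex_Main "HOL-Library.Disjoint_Sets" "HOL-Number_Theory.Cong"
begin

definition L :: "real \<Rightarrow> real \<Rightarrow> real" where
  "L c x = exp (c * sqrt (ln x * ln (ln x)))"

definition arith_prog :: "int \<Rightarrow> int \<Rightarrow> int set" where
  "arith_prog a q = {n. [n = a] (mod q)}"

definition admissible_size :: "real \<Rightarrow> nat \<Rightarrow> bool" where
  "admissible_size x k \<longleftrightarrow>
     (\<exists>(q :: nat \<Rightarrow> int) (a :: nat \<Rightarrow> int).
        strict_mono_on {1..k} q \<and>
        (\<forall>i\<in>{1..k}. 2 \<le> q i \<and> of_int (q i) \<le> x) \<and>
        disjoint_family_on (\<lambda>i. arith_prog (a i) (q i)) {1..k})"

definition f :: "real \<Rightarrow> nat" where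
  "f x = Max {k. admissible_size x k}"

(* The maximum is attained: the set is nonempty (k = 0 is vacuously admissible) and finite. *)

lemma admissible_size_0: "admissible_size x 0"
  by (auto simp: admissible_size_def strict_mono_on_def disjoint_family_on_def)

lemma finite_admissible_size: "finite {k. admissible_size x k}"
proof (rule finite_subset)
  show "{k. admissible_size x k} \<subseteq> {..card {2..\<lfloor>x\<rfloor>}}"
  proof
    fix k assume "k \<in> {k. admissible_size x k}"
    then obtain q :: "nat \<Rightarrow> int" where q: "strict_mono_on {1..k} q"
      and bd: "\<forall>i\<in>{1..k}. 2 \<le> q i \<and> of_int (q i) \<le> x"
      unfolding admissible_size_def by blast
    have "inj_on q {1..k}"
      using q by (rule strict_mono_on_imp_inj_on)
    moreover have "q ` {1..k} \<subseteq> {2..\<lfloor>x\<rfloor>}"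
      using bd by (auto simp: le_floor_iff)
    ultimately have "card {1..k} \<le> card {2..\<lfloor>x\<rfloor>}"
      by (intro card_inj_on_le) auto
    then show "k \<in> {..card {2..\<lfloor>x\<rfloor>}}" by simp
  qed
qed simp

end

(* Let D be an integer and let n = p_1 p_2 ... p_k be D-smooth with primes p_1 >= ... >= p_k.
   Attach to the modulus D * n the residue whose mixed radix digits in bases D, p_1, p_2, ... are
   p_1 - 1, p_2 - 1, ..., p_k - 1, 0. If n and n' have the same first i primes, then the next digit
   has the same base for both and tells p_{i+1} from p'_{i+1}, so these progressions are disjoint.
   Hence f(x) is at least the number Psi(x / D, D) of D-smooth numbers up to x / D.
   With the von Mangoldt function, Psi(X, D) ln X >= sum_{d <= D} Lambda(d) Psi(X / d, D).
   Restricting to D^(1 - eps) < d <= D and iterating j ~ ln X / ((1 - eps) ln D) times gives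
   Psi(X, D) >= X / (2 (j + 1)!) (eps / 2)^j. The choice D = L(1 / sqrt 2, x) balances the two
   losses D and j!, each of which is then L(1 / sqrt 2 + o(1), x) as eps tends to 0. *)
theory Submission
  imports Defs "HOL-Number_Theory.Prime_Powers" "HOL-Library.Infinite_Set" "HOL-Real_Asymp.Real_Asymp"
begin

section \<open>Mertens-type bounds for the von Mangoldt function\<close>

text \<open>From \<open>N\<close> to \<open>Suc N\<close> the quotient by \<open>d\<close> grows by
  one exactly when \<open>d\<close> divides \<open>Suc N\<close>, and the values of
  \<open>mangoldt\<close> over the divisors of \<open>Suc N\<close> add up to its logarithm.\<close>

lemma ln_fact_eq_sum_mangoldt:
  "ln (fact N :: real) = (\<Sum>d=1..N. mangoldt d * real (N div d))"
proof (induction N)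
  case (Suc N)
  have "(\<Sum>d=1..Suc N. mangoldt d * real (Suc N div d)) =
      (\<Sum>d=1..Suc N. mangoldt d * real (N div d) + (if d dvd Suc N then mangoldt d else 0))"
    by (intro sum.cong) (auto simp: div_Suc dvd_eq_mod_eq_0 algebra_simps)
  also have "\<dots> = ln (fact N) + (\<Sum>d=1..Suc N. if d dvd Suc N then mangoldt d else 0)"
    using Suc by (simp add: sum.distrib)
  also have "(\<Sum>d=1..Suc N. if d dvd Suc N then mangoldt d else 0) = (\<Sum>d | d dvd Suc N. mangoldt d :: real)"
    by (intro sum.mono_neutral_cong_right) (auto dest: dvd_imp_le intro!: Suc_leI Nat.gr0I)
  also have "\<dots> = ln (real (Suc N))"
    using mangoldt_sum[of "Suc N", where ?'a = real] by simp
  also have "ln (fact N) + ln (real (Suc N)) = ln (fact (Suc N))"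
    by (simp add: ln_mult del: of_nat_Suc)
  finally show ?case by simp
qed simp

lemma ln_fact_ge: "ln (fact N :: real) \<ge> real N * ln (real N) - real N"
proof (induction N)
  case (Suc N)
  have "real N * (ln (real (Suc N)) - ln (real N)) \<le> 1"
  proof (cases "N = 0")
    case False
    have "ln (real (Suc N)) - ln (real N) = ln (1 + 1 / real N)"
      using False ln_divide_pos[of "real (Suc N)" "real N"] by (simp add: add_divide_distrib add.commute)
    also have "\<dots> \<le> 1 / real N"
      by (rule ln_add_one_self_le_self) simp
    finally show ?thesis using False by (simp add: field_simps)
  qed simp
  moreover have "ln (fact (Suc N) :: real) = ln (fact N) + ln (real (Suc N))"
    by (simp add: ln_mult del: of_nat_Suc)
  ultimately show ?case using Suc.IH by (simp add: algebra_simps)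
qed simp

text \<open>Replacing \<open>N div d\<close> by \<open>N / d\<close> only enlarges the sum for
  \<open>ln (fact N)\<close>, so the Stirling-type lower bound carries over after division by
  \<open>N\<close>.\<close>

lemma sum_mangoldt_div_ge:
  assumes "N > 0"
  shows "(\<Sum>d=1..N. mangoldt d / real d) \<ge> ln (real N) - 1"
proof -
  have "real N * ln (real N) - real N \<le> (\<Sum>d=1..N. mangoldt d * real (N div d))"
    using ln_fact_ge[of N] by (simp add: ln_fact_eq_sum_mangoldt)
  also have "\<dots> \<le> (\<Sum>d=1..N. real N * (mangoldt d / real d))"
  proof (rule sum_mono)
    fix d assume "d \<in> {1..N}"
    have "mangoldt d * real (N div d) \<le> mangoldt d * (real N / real d)"
      by (intro mult_left_mono mangoldt_nonneg) (simp add: of_nat_div_le_of_nat)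
    then show "mangoldt d * real (N div d) \<le> real N * (mangoldt d / real d)"
      by (simp add: algebra_simps)
  qed
  also have "\<dots> = real N * (\<Sum>d=1..N. mangoldt d / real d)"
    by (simp add: sum_distrib_left)
  finally have "real N * (ln (real N) - 1) \<le> real N * (\<Sum>d=1..N. mangoldt d / real d)"
    by (simp add: algebra_simps)
  then show ?thesis using assms by simp
qed

text \<open>Comparing with \<open>(K * N)!\<close> rather than \<open>N!\<close> makes the rounding in \<open>K * N div d\<close>
  cost only a factor \<open>1 + 1 / K\<close>, so Chebyshev's upper bound is not needed.\<close>

lemma sum_mangoldt_div_le:
  assumes "N > 0" "K > 0"
  shows "(\<Sum>d=1..N. mangoldt d / real d) \<le> (1 + 1 / real K) * (ln (real N) + ln (real K))"
proof -
  define M where "M = K * N"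
  have M: "M > 0" using assms by (simp add: M_def)
  have "(\<Sum>d=1..N. real M * (mangoldt d / real d)) \<le>
        (\<Sum>d=1..N. (1 + 1 / real K) * (mangoldt d * real (M div d)))"
  proof (rule sum_mono)
    fix d assume d: "d \<in> {1..N}"
    have "K \<le> M div d"
      using d by (auto simp: M_def less_eq_div_iff_mult_less_eq)
    then have "real K \<le> real (M div d)" by simp
    moreover have "real M / real d \<le> real (M div d) + 1"
      using d by (simp add: of_nat_of_nat_div_aux[of M d])
    moreover have "1 \<le> real (M div d) / real K" using calculation(1) assms(2) by simp
    ultimately have "real M / real d \<le> (1 + 1 / real K) * real (M div d)"
      by (simp add: distrib_right)
    then have "mangoldt d * (real M / real d) \<le> mangoldt d * ((1 + 1 / real K) * real (M div d))"
      by (intro mult_left_mono mangoldt_nonneg)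
    then show "real M * (mangoldt d / real d) \<le> (1 + 1 / real K) * (mangoldt d * real (M div d))"
      by (simp add: algebra_simps)
  qed
  also have "\<dots> = (1 + 1 / real K) * (\<Sum>d=1..N. mangoldt d * real (M div d))"
    by (simp add: sum_distrib_left)
  also have "(\<Sum>d=1..N. mangoldt d * real (M div d)) \<le> (\<Sum>d=1..M. mangoldt d * real (M div d))"
    using assms by (intro sum_mono2) (auto simp: M_def mangoldt_nonneg intro: order_trans)
  also have "\<dots> = ln (fact M)" by (simp add: ln_fact_eq_sum_mangoldt)
  also have "\<dots> \<le> ln (real (M ^ M))"
    using fact_le_power[of M, where ?'a = real] M by (subst ln_le_cancel_iff) (auto simp del: of_nat_power)
  also have "\<dots> = real M * (ln (real N) + ln (real K))"
    using assms M by (simp add: ln_realpow) (simp add: M_def ln_mult)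
  finally have "real M * (\<Sum>d=1..N. mangoldt d / real d) \<le>
      (1 + 1 / real K) * (real M * (ln (real N) + ln (real K)))"
    by (simp add: sum_distrib_left mult_left_mono)
  also have "\<dots> = real M * ((1 + 1 / real K) * (ln (real N) + ln (real K)))"
    by (rule mult.left_commute)
  finally show ?thesis using M by (simp only: mult_le_cancel_left_pos of_nat_0_less_iff)
qed

text \<open>Subtract the upper bound for d <= D^(1 - eps) from the lower bound for d <= D: the main
  terms differ by a positive multiple of ln D, which outgrows all constants.\<close>

lemma sum_mangoldt_div_window:
  fixes \<epsilon> :: real
  assumes \<epsilon>: "0 < \<epsilon>" "\<epsilon> < 1"
  shows "\<forall>\<^sub>F D :: nat in sequentially.
    (\<Sum>d | d \<le> D \<and> real d > real D powr (1 - \<epsilon>). mangoldt d / real d) \<ge> \<epsilon> / 2 * ln (real D)"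
proof -
  \<comment> \<open>With 1 / K <= eps / 2 the factor 1 + 1 / K stays below 1 / (1 - eps), so the
    main terms do not cancel.\<close>
  define K where "K = nat \<lceil>2 / \<epsilon>\<rceil>"
  have K: "K > 0" "1 / real K \<le> \<epsilon> / 2"
  proof -
    have *: "real K \<ge> 2 / \<epsilon>" unfolding K_def by linarith
    show "K > 0" using \<epsilon> by (simp add: K_def)
    then show "1 / real K \<le> \<epsilon> / 2" using * \<epsilon> by (simp add: field_simps)
  qed
  have ev: "\<forall>\<^sub>F D :: nat in sequentially.
     ln (real D) - 1 - (1 + \<epsilon> / 2) * ((1 - \<epsilon>) * ln (real D) + ln (real K)) \<ge> \<epsilon> / 2 * ln (real D)"
  proof -
    \<comment> \<open>Since (1 + eps/2)(1 - eps) = 1 - eps/2 - eps^2/2, keeping eps/2 * ln D leaves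
      a surplus of eps^2/2 * ln D to absorb the constants.\<close>
    have "\<forall>\<^sub>F D :: nat in sequentially. \<epsilon>\<^sup>2 / 2 * ln (real D) \<ge> 1 + (1 + \<epsilon> / 2) * ln (real K)"
      using \<epsilon> by real_asymp
    then show ?thesis
      by eventually_elim (simp add: algebra_simps power2_eq_square)
  qed
  show ?thesis
    using ev eventually_gt_at_top[of 0]
  proof eventually_elim
    case (elim D)
    define N where "N = nat \<lfloor>real D powr (1 - \<epsilon>)\<rfloor>"
    have D1: "real D powr (1 - \<epsilon>) \<ge> 1" using elim \<epsilon> by (simp add: ge_one_powr_ge_zero)
    have Nle: "real N \<le> real D powr (1 - \<epsilon>)" unfolding N_def using D1 by linarith
    have N0: "N > 0" using D1 by (simp add: N_def)
    have "real D powr (1 - \<epsilon>) \<le> real D powr 1"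
      using elim \<epsilon> by (intro powr_mono) auto
    then have "N \<le> D" using Nle by simp
    have iff: "real d > real D powr (1 - \<epsilon>) \<longleftrightarrow> d > N" for d
      unfolding N_def by (simp add: floor_less_iff nat_less_iff)

    have "ln (real N) \<le> (1 - \<epsilon>) * ln (real D)"
      using Nle N0 elim by (metis ln_powr ln_mono of_nat_0_less_iff)
    then have "(1 + 1 / real K) * (ln (real N) + ln (real K)) \<le>
               (1 + \<epsilon> / 2) * ((1 - \<epsilon>) * ln (real D) + ln (real K))"
      using K N0 \<epsilon> by (intro mult_mono add_mono) auto
    then have "(\<Sum>d=1..N. mangoldt d / real d) \<le> (1 + \<epsilon> / 2) * ((1 - \<epsilon>) * ln (real D) + ln (real K))"
      using sum_mangoldt_div_le[OF N0 K(1)] by linarith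
    moreover have "(\<Sum>d=1..D. mangoldt d / real d) =
       (\<Sum>d=1..N. mangoldt d / real d) + (\<Sum>d\<in>{N<..D}. mangoldt d / real d)"
      using \<open>N \<le> D\<close> by (subst sum.union_disjoint [symmetric]) (auto intro!: sum.cong)
    moreover have "{d. d \<le> D \<and> real d > real D powr (1 - \<epsilon>)} = {N<..D}"
      by (auto simp: iff)
    ultimately show ?case
      using sum_mangoldt_div_ge[OF elim(2)] elim(1) by simp
  qed
qed

section \<open>Lower bound for the number of smooth integers\<close>

definition smooth :: "nat \<Rightarrow> nat \<Rightarrow> bool" where
  "smooth D n \<longleftrightarrow> n > 0 \<and> (\<forall>p. prime p \<longrightarrow> p dvd n \<longrightarrow> p \<le> D)"

definition smooth_count :: "real \<Rightarrow> nat \<Rightarrow> nat" where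
  "smooth_count X D = card {n. smooth D n \<and> real n \<le> X}"

lemma smooth_pos: "smooth D n \<Longrightarrow> n > 0"
  by (simp add: smooth_def)

lemma smooth_if_le: "0 < n \<Longrightarrow> n \<le> D \<Longrightarrow> smooth D n"
  by (auto simp: smooth_def dest: dvd_imp_le)

lemma smooth_mult: "smooth D m \<Longrightarrow> smooth D n \<Longrightarrow> smooth D (m * n)"
  by (auto simp: smooth_def prime_dvd_mult_iff)

lemma finite_smooth_le: "finite {n. smooth D n \<and> real n \<le> X}"
  by (rule finite_subset[of _ "{..nat \<lfloor>X\<rfloor>}"]) (auto simp: le_nat_floor)

text \<open>Each d <= D is itself smooth, so multiplication by d injects the smooth numbers up to X
  / d into the smooth multiples of d up to X. Swapping the sums leaves for each n at most the sum of
  \<open>mangoldt\<close> over its divisors, which is ln n <= ln X.\<close>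

lemma sum_mangoldt_smooth_count_le:
  assumes S: "S \<subseteq> {1..D}" and X: "X \<ge> 1"
  shows "(\<Sum>d\<in>S. mangoldt d * real (smooth_count (X / real d) D)) \<le> ln X * real (smooth_count X D)"
proof -
  define A where "A = {n. smooth D n \<and> real n \<le> X}"
  have finA: "finite A" unfolding A_def by (rule finite_smooth_le)
  have finS: "finite S" using S finite_subset by blast
  have "(\<Sum>d\<in>S. mangoldt d * real (smooth_count (X / real d) D)) \<le>
        (\<Sum>d\<in>S. mangoldt d * real (card {n\<in>A. d dvd n}))"
  proof (intro sum_mono mult_left_mono mangoldt_nonneg)
    fix d assume "d \<in> S"
    then have d: "0 < d" "d \<le> D" using S by auto
    have "smooth_count (X / real d) D \<le> card {n\<in>A. d dvd n}"
      unfolding smooth_count_def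
    proof (rule card_inj_on_le)
      show "inj_on ((*) d) {n. smooth D n \<and> real n \<le> X / real d}"
        using d by (auto simp: inj_on_def)
      show "(*) d ` {n. smooth D n \<and> real n \<le> X / real d} \<subseteq> {n \<in> A. d dvd n}"
        using d by (auto simp: A_def field_simps intro: smooth_mult smooth_if_le)
    qed (use finA in auto)
    then show "real (smooth_count (X / real d) D) \<le> real (card {n\<in>A. d dvd n})" by simp
  qed
  also have "\<dots> = (\<Sum>d\<in>S. \<Sum>n | n \<in> A \<and> d dvd n. mangoldt d)"
    by (simp add: mult.commute)
  also have "\<dots> = (\<Sum>n\<in>A. \<Sum>d | d \<in> S \<and> d dvd n. mangoldt d)"
    by (rule sum.swap_restrict) (use finA finS in auto)
  also have "\<dots> \<le> (\<Sum>n\<in>A. \<Sum>d | d dvd n. mangoldt d)"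
    by (intro sum_mono sum_mono2) (auto simp: mangoldt_nonneg A_def dest: smooth_pos)
  also have "\<dots> = (\<Sum>n\<in>A. ln (real n))"
  proof (rule sum.cong)
    fix n assume "n \<in> A"
    then have "n \<noteq> 0" by (auto simp: A_def dest: smooth_pos)
    then show "(\<Sum>d | d dvd n. mangoldt d) = ln (real n)"
      using mangoldt_sum[of n, where ?'a = real] by simp
  qed simp
  also have "\<dots> \<le> (\<Sum>n\<in>A. ln X)"
    using X by (intro sum_mono ln_mono) (auto simp: A_def dest: smooth_pos)
  also have "\<dots> = ln X * real (smooth_count X D)"
    by (simp add: smooth_count_def A_def)
  finally show ?thesis .
qed

lemma smooth_count_ge_half:
  assumes "1 \<le> X" "X \<le> real D"
  shows "real (smooth_count X D) \<ge> X / 2"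
proof -
  have "{n. smooth D n \<and> real n \<le> X} = {1..nat \<lfloor>X\<rfloor>}"
  proof safe
    fix n assume "n \<in> {1..nat \<lfloor>X\<rfloor>}"
    then have "0 < n" "real n \<le> X" using assms by (auto simp: le_nat_iff le_floor_iff)
    then show "real n \<le> X" "smooth D n" using assms by (auto intro!: smooth_if_le)
  qed (use smooth_pos in \<open>auto simp: le_nat_floor Suc_le_eq\<close>)
  then have "real (smooth_count X D) = of_int \<lfloor>X\<rfloor>"
    using assms by (simp add: smooth_count_def)
  also have "of_int \<lfloor>X\<rfloor> \<ge> X / 2" proof -
    have "\<lfloor>X\<rfloor> \<ge> 1" using assms by simp
    then show ?thesis by linarith
  qed
  finally show ?thesis .
qed

text \<open>Induction on \<open>j\<close>, applied to X / d for d in the window: d > D^(1 - eps)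
  uses up one factor of the bound on X. A step gains eps/2 * ln D from the window sum and pays ln X
  <= (j + 2) * ln D; the payments 2, 3, ... multiply to the factorial. \<open>X\<close> is
  generalised, while the window hypothesis concerns only \<open>D\<close> and serves every
  step.\<close>

lemma smooth_count_ge:
  fixes \<epsilon> :: real
  assumes \<epsilon>: "0 < \<epsilon>" "\<epsilon> < 1" and D: "D \<ge> 2"
    and window: "(\<Sum>d | d \<le> D \<and> real d > real D powr (1 - \<epsilon>). mangoldt d / real d) \<ge> \<epsilon> / 2 * ln (real D)"
  assumes "1 \<le> X" "X \<le> real D * (real D powr (1 - \<epsilon>)) ^ j"
  shows "real (smooth_count X D) \<ge> X / 2 * ((\<epsilon> / 2) ^ j / fact (j + 1))"
  using assms(5,6)
proof (induction j arbitrary: X)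
  case 0
  then show ?case using smooth_count_ge_half[of X D] by simp
next
  case (Suc j)
  define g where "g j = (\<epsilon> / 2) ^ j / fact (j + 1)" for j :: nat
  have g_Suc: "g (Suc j) * (real j + 2) = g j * (\<epsilon> / 2)"
    by (simp add: g_def divide_simps)
  have g_nonneg: "g i \<ge> 0" for i using \<epsilon> by (simp add: g_def)
  show ?case
  proof (cases "X \<le> real D")
    \<comment> \<open>Here X / d may drop below 1, outside the reach of the induction hypothesis;
      the bound X / 2 is already strong enough.\<close>
    case True
    have "g (Suc j) \<le> 1" unfolding g_def
      using power_le_one[of "\<epsilon> / 2" "Suc j"] fact_ge_1[of "Suc j + 1", where ?'a = real] \<epsilon>
      by (subst pos_divide_le_eq) auto
    then have "X / 2 * g (Suc j) \<le> X / 2 * 1"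
      using Suc.prems by (intro mult_left_mono) auto
    then show ?thesis using smooth_count_ge_half[of X D] True Suc.prems
      unfolding g_def by linarith
  next
    case False
    define Y where "Y = real D powr (1 - \<epsilon>)"
    define W where "W = {d. d \<le> D \<and> real d > Y}"
    have Y: "0 < Y" "1 \<le> Y" "Y \<le> real D"
    proof -
      show "1 \<le> Y" using D \<epsilon> by (simp add: Y_def ge_one_powr_ge_zero)
      then show "0 < Y" by simp
      show "Y \<le> real D" using D \<epsilon> powr_mono[of "1 - \<epsilon>" 1 "real D"] by (simp add: Y_def)
    qed
    have lnD: "ln (real D) > 0" using D by simp
    have W: "W \<subseteq> {1..D}" using Y by (auto simp: W_def Suc_le_eq intro!: Nat.gr0I)
    have IH: "real (smooth_count (X / real d) D) \<ge> X / real d / 2 * g j" if "d \<in> W" for d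
      unfolding g_def
    proof (rule Suc.IH)
      have d: "0 < d" "real d \<le> real D" "real d > Y" using that W by (auto simp: W_def)
      show "1 \<le> X / real d" using d False by simp
      have "X / real d \<le> X / Y" using d Y Suc.prems by (intro divide_left_mono) auto
      also have "\<dots> \<le> real D * Y ^ j"
        using Suc.prems(2) Y by (simp add: field_simps Y_def)
      finally show "X / real d \<le> real D * (real D powr (1 - \<epsilon>)) ^ j" by (simp add: Y_def)
    qed
    have "ln X \<le> ln (real D * Y ^ Suc j)"
      using Suc.prems by (intro ln_mono) (auto simp: Y_def)
    also have "\<dots> = ln (real D) + real (Suc j) * ln Y"
      using D Y by (simp add: ln_mult ln_realpow del: power_Suc)
    also have "\<dots> \<le> ln (real D) + real (Suc j) * ln (real D)"
      using Y D by (intro add_left_mono mult_left_mono ln_mono) auto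
    finally have lnX: "ln X \<le> (real j + 2) * ln (real D)" by (simp add: algebra_simps)
    have "ln (real D) * ((real j + 2) * (X / 2 * g (Suc j))) = X / 2 * g j * (\<epsilon> / 2 * ln (real D))"
    proof -
      have "ln (real D) * ((real j + 2) * (X / 2 * g (Suc j))) =
            X / 2 * ln (real D) * (g (Suc j) * (real j + 2))"
        by (simp only: mult_ac)
      then show ?thesis unfolding g_Suc by (simp only: mult_ac)
    qed
    also have "\<dots> \<le> X / 2 * g j * (\<Sum>d\<in>W. mangoldt d / real d)"
      using window Suc.prems g_nonneg by (intro mult_left_mono) (auto simp: W_def Y_def)
    also have "\<dots> = (\<Sum>d\<in>W. mangoldt d * (X / real d / 2 * g j))"
      by (simp add: sum_distrib_left algebra_simps)
    also have "\<dots> \<le> (\<Sum>d\<in>W. mangoldt d * real (smooth_count (X / real d) D))"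
      by (intro sum_mono mult_left_mono IH mangoldt_nonneg)
    also have "\<dots> \<le> ln X * real (smooth_count X D)"
      using W Suc.prems(1) by (rule sum_mangoldt_smooth_count_le)
    also have "\<dots> \<le> (real j + 2) * ln (real D) * real (smooth_count X D)"
      using lnX by (intro mult_right_mono) auto
    finally have "ln (real D) * (real j + 2) * (X / 2 * g (Suc j)) \<le>
                  ln (real D) * (real j + 2) * real (smooth_count X D)"
      by (simp add: algebra_simps)
    moreover have "ln (real D) * (real j + 2) > 0" using lnD by simp
    ultimately show ?thesis
      unfolding g_def by (simp only: mult_le_cancel_left_pos)
  qed
qed

section \<open>Mixed radix residues and disjointness of the progressions\<close>

text \<open>The inserted 1 keeps \<open>Max\<close> away from the empty set and gives
  \<open>gpf 1 = 1\<close>, so that the digit \<open>gpf n - 1\<close> is 0 exactly at the end of an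
  expansion.\<close>

definition gpf :: "nat \<Rightarrow> nat" where
  "gpf n = Max (insert 1 (prime_factors n))"

lemma gpf_cases:
  assumes "n > 1"
  shows "prime (gpf n)" "gpf n dvd n" "\<And>p. prime p \<Longrightarrow> p dvd n \<Longrightarrow> p \<le> gpf n"
proof -
  obtain p where p: "p \<in> prime_factors n"
    using assms prime_factor_nat[of n] by (auto simp: prime_factors_dvd)
  then have "p > 1" using prime_gt_1_nat in_prime_factors_imp_prime by blast
  moreover have "gpf n \<ge> p" using p by (simp add: gpf_def)
  moreover have "gpf n \<in> insert 1 (prime_factors n)" unfolding gpf_def by (rule Max_in) auto
  ultimately have "gpf n \<in> prime_factors n" by auto
  then show "prime (gpf n)" "gpf n dvd n" by (auto simp: prime_factors_dvd)
  show "q \<le> gpf n" if "prime q" "q dvd n" for q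
    using that assms by (simp add: gpf_def prime_factors_dvd)
qed

lemma gpf_1 [simp]: "gpf (Suc 0) = 1"
  by (simp add: gpf_def)

lemma gpf_pos: "gpf n > 0"
  unfolding gpf_def by (rule less_le_trans[of _ 1]) auto

lemma gpf_le:
  assumes "smooth D n" "D > 0"
  shows "gpf n \<le> D"
proof (cases "n = 1")
  case False
  then show ?thesis using assms gpf_cases[of n] smooth_pos[of D n]
    by (auto simp: smooth_def)
qed (use assms in auto)

text \<open>Invariant of the recursion for \<open>residue\<close>: the cofactor is smooth with
  respect to the prime just removed, so that prime can be the next base.\<close>

lemma smooth_div_gpf:
  assumes "n > 1"
  shows "smooth (gpf n) (n div gpf n)"
proof -
  from gpf_cases(2)[OF assms] have *: "n = gpf n * (n div gpf n)" by simp
  have "n div gpf n > 0" using assms * by (metis gr0I mult_0_right not_less_zero)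
  moreover have "p \<le> gpf n" if "prime p" "p dvd n div gpf n" for p
    using gpf_cases(3)[OF assms that(1)] that(2) * by (metis dvd_mult)
  ultimately show ?thesis by (simp add: smooth_def)
qed

text \<open>The first argument is the base of the lowest digit, and the intended modulus is
  \<open>D * n\<close>. The prime \<open>gpf n\<close> is announced by the current digit and then
  becomes the next base.\<close>

function residue :: "nat \<Rightarrow> nat \<Rightarrow> int" where
  "residue D n =
     (if n \<le> 1 then 0 else int (gpf n) - 1 + int D * residue (gpf n) (n div gpf n))"
  by auto
termination
proof (relation "measure snd")
  fix n :: nat assume "\<not> n \<le> 1"
  then have "n > 1" by simp
  from prime_gt_1_nat[OF gpf_cases(1)[OF this]] this
  have "n div gpf n < n" by (intro div_less_dividend) auto
  then show "((gpf n, n div gpf n), D, n) \<in> measure snd" for D by simp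
qed simp

declare residue.simps [simp del]

text \<open>Smoothness puts \<open>gpf n - 1\<close> between 0 and \<open>D - 1\<close>, so it is a
  genuine digit in base \<open>D\<close>; for n = 1 it agrees with the final digit 0.\<close>

lemma residue_mod:
  assumes "smooth D n" "D > 0"
  shows "residue D n mod int D = int (gpf n) - 1"
proof (cases "n = 1")
  case False
  then have "n > 1" using smooth_pos[OF assms(1)] by simp
  then have "residue D n = int (gpf n) - 1 + int D * residue (gpf n) (n div gpf n)"
    by (subst residue.simps) simp
  then show ?thesis using gpf_le[OF assms] gpf_pos[of n] by (simp add: mod_pos_pos_trivial)
qed (use assms in \<open>simp add: residue.simps\<close>)

text \<open>Disjointness in contrapositive form: a common element \<open>t\<close> determines the
  number. Its lowest digit forces the same largest prime p on both sides; removing the digit leaves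
  the same situation for the cofactors with base p. Hence \<open>D\<close> and \<open>t\<close> vary
  in the induction.\<close>

lemma residue_disjoint:
  assumes "[t = residue D n] (mod int (D * n))" "[t = residue D m] (mod int (D * m))"
    and "smooth D n" "smooth D m" "D > 0"
  shows "n = m"
  using assms
proof (induction n arbitrary: D m t rule: less_induct)
  case (less n)
  define p where "p = gpf n"
  have "t mod int D = residue D n mod int D" "t mod int D = residue D m mod int D"
    using cong_dvd_modulus[OF less.prems(1), of "int D"]
      cong_dvd_modulus[OF less.prems(2), of "int D"] by (simp_all add: unique_euclidean_semiring_class.cong_def)
  then have t: "t mod int D = int p - 1" "gpf m = p"
    using residue_mod[of D n] residue_mod[of D m] less.prems p_def by simp_all
  \<comment> \<open>Digit 0 marks the number 1, since every prime gives a positive digit; so neither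
    expansion can end before the other.\<close>
  have one_iff: "k = 1 \<longleftrightarrow> gpf k = 1" if "k > 0" for k
    using that gpf_cases(1)[of k] by (cases "k = 1") auto
  show ?case
  proof (cases "n = 1")
    case True
    then show ?thesis using one_iff[of m] t smooth_pos[OF less.prems(4)] by (auto simp: p_def)
  next
    case False
    then have n: "n > 1" using smooth_pos[OF less.prems(3)] by simp
    have m: "m > 1"
      using False one_iff[of n] one_iff[of m] t n smooth_pos[OF less.prems(4)]
      by (cases "m = 1") (auto simp: p_def)
    define s where "s = t div int D"
    have ts: "t = int p - 1 + int D * s"
      using t(1) by (metis s_def mod_mult_div_eq)
    \<comment> \<open>Cancelling the digit and then the factor \<open>D\<close> turns the modulus
      \<open>D * k\<close> into \<open>k\<close>, which is the new base times the new
      cofactor.\<close>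
    have step: "[s = residue p (k div p)] (mod int (p * (k div p)))"
      if "[t = residue D k] (mod int (D * k))" "gpf k = p" "k > 1" for k
    proof -
      have k: "p * (k div p) = k" using gpf_cases(2)[OF that(3)] that(2) by simp
      have "residue D k = int p - 1 + int D * residue p (k div p)"
        using that by (subst residue.simps) simp
      then have "[int D * s = int D * residue p (k div p)] (mod int D * int k)"
        using that(1) unfolding ts by (simp add: cong_add_lcancel)
      then have "[s = residue p (k div p)] (mod int k)"
        using less.prems(5) by (simp add: cong_iff_dvd_diff flip: right_diff_distrib)
      then show ?thesis by (simp only: k)
    qed
    have "n div p = m div p"
    proof (rule less.IH)
      have "prime p" using gpf_cases(1)[OF n] by (simp add: p_def)
      then show "n div p < n" using n prime_gt_1_nat[of p] by (intro div_less_dividend) auto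
      show "[s = residue p (n div p)] (mod int (p * (n div p)))"
        using less.prems(1) n by (intro step) (auto simp: p_def)
      show "[s = residue p (m div p)] (mod int (p * (m div p)))"
        using less.prems(2) m t by (intro step) auto
      show "smooth p (n div p)" "smooth p (m div p)" "p > 0"
        using smooth_div_gpf[OF n] smooth_div_gpf[OF m] t gpf_pos[of n] by (auto simp: p_def)
    qed
    then show ?thesis
      using gpf_cases(2)[OF n] gpf_cases(2)[OF m] t p_def by (metis dvd_mult_div_cancel)
  qed
qed

text \<open>The moduli are D * n for smooth n <= x / D, listed in increasing order; the factor D >=
  2 makes even n = 1 yield a legal modulus.\<close>

lemma smooth_count_le_f:
  assumes D: "D \<ge> 2"
  shows "smooth_count (x / real D) D \<le> f x"
proof -
  define A where "A = {n. smooth D n \<and> real n \<le> x / real D}"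
  obtain h where h: "bij_betw h {..<card A} A" and mono: "strict_mono_on {..<card A} h"
    using ex_bij_betw_strict_mono_card[OF finite_smooth_le] unfolding A_def by blast
  \<comment> \<open>The shift reconciles the enumeration \<open>h\<close>, which starts at 0, with
    the indices of \<open>admissible_size\<close>, which start at 1.\<close>
  define q where "q i = int (D * h (i - 1))" for i
  define a where "a i = residue D (h (i - 1))" for i
  have hA: "h (i - 1) \<in> A" if "i \<in> {1..card A}" for i
    using h that by (intro bij_betwE[OF h, rule_format]) auto
  have "admissible_size x (card A)"
    unfolding admissible_size_def
  proof (intro exI conjI ballI)
    show "strict_mono_on {1..card A} q"
    proof (rule strict_mono_onI)
      fix i j assume "i \<in> {1..card A}" "j \<in> {1..card A}" "i < j"
      then have "h (i - 1) < h (j - 1)" by (intro strict_mono_onD[OF mono]) auto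
      then show "q i < q j" using D by (simp add: q_def)
    qed
    fix i assume "i \<in> {1..card A}"
    from hA[OF this] have *: "h (i - 1) > 0" "real (h (i - 1)) \<le> x / real D"
      by (auto simp: A_def smooth_pos)
    show "of_int (q i) \<le> x" using * D by (simp add: q_def field_simps)
    have "2 * 1 \<le> D * h (i - 1)" using * D by (intro mult_le_mono) auto
    then show "2 \<le> q i" by (simp add: q_def flip: of_nat_mult)
  next
    show "disjoint_family_on (\<lambda>i. arith_prog (a i) (q i)) {1..card A}"
      unfolding disjoint_family_on_def
    proof (intro ballI impI)
      fix i j assume ij: "i \<in> {1..card A}" "j \<in> {1..card A}" "i \<noteq> j"
      have "h (i - 1) \<noteq> h (j - 1)"
        using ij inj_on_eq_iff[OF bij_betw_imp_inj_on[OF h], of "i - 1" "j - 1"]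
        by (cases i; cases j) auto
      then show "arith_prog (a i) (q i) \<inter> arith_prog (a j) (q j) = {}"
        using residue_disjoint[of _ D "h (i - 1)" "h (j - 1)"] hA[OF ij(1)] hA[OF ij(2)] D
        by (auto simp: arith_prog_def a_def q_def A_def)
    qed
  qed
  then show ?thesis
    unfolding f_def smooth_count_def A_def by (intro Max_ge finite_admissible_size) auto
qed

section \<open>Choice of parameters and asymptotics\<close>

text \<open>With l = ln x, \<open>B l\<close> will bound the number of iterations. It is asymptotic
  to sqrt (l / ln l) / (a * b) and its logarithm to (ln l) / 2, so the factorial costs sqrt (l * ln
  l) / (2 * a * b), while the term with \<open>c\<close> is of lower order.\<close>

lemma loss_asymptotics:
  fixes a b c :: real
  assumes "a > 0" "b > 0"
  defines "B \<equiv> (\<lambda>l. l / (b * (a * sqrt (l * ln l) - ln 2)) + 1)"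
  shows "((\<lambda>l. (ln 2 + a * sqrt (l * ln l) + B l * c + (B l + 1) * ln (B l + 1)) / sqrt (l * ln l))
     \<longlongrightarrow> a + 1 / (2 * a * b)) at_top"
  unfolding B_def using assms by (real_asymp simp: field_simps)

text \<open>The conjunct \<open>f x > 0\<close> has content: for \<open>f x = 0\<close> the quotient
  and its logarithm would both default to 0.\<close>

lemma eventually_ln_div_f_less:
  fixes \<delta> :: real
  assumes "\<delta> > 0"
  shows "\<forall>\<^sub>F x in at_top. f x > 0 \<and> ln (x / real (f x)) < (sqrt 2 + \<delta>) * sqrt (ln x * ln (ln x))"
proof -
  define \<epsilon> where "\<epsilon> = min (1 / 2) (\<delta> / 2)"
  have \<epsilon>: "0 < \<epsilon>" "\<epsilon> < 1" "\<epsilon> \<le> 1 / 2" "2 * \<epsilon> \<le> \<delta>" using assms by (auto simp: \<epsilon>_def min_def)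
  \<comment> \<open>This value minimises a + 1 / (2 * a), with minimum sqrt 2.\<close>
  define a :: real where "a = 1 / sqrt 2"
  have a: "a > 0" by (simp add: a_def)
  define s where "s x = sqrt (ln x * ln (ln x))" for x :: real
  define c where "c = ln (2 / \<epsilon>)"
  have c: "c \<ge> 0" using \<epsilon> by (simp add: c_def)
  \<comment> \<open>The \<open>ln 2\<close> pays for rounding \<open>D x\<close> down, the final 1
    for rounding \<open>j\<close> up.\<close>
  define B where "B l = l / ((1 - \<epsilon>) * (a * sqrt (l * ln l) - ln 2)) + 1" for l :: real
  define D where "D x = nat \<lfloor>exp (a * s x)\<rfloor>" for x

  \<comment> \<open>Here a = 1 / (2 * a), and 1 / (1 - eps) <= 1 + 2 * eps because eps <= 1/2; the
    rate is thus at most sqrt 2 * (1 + eps).\<close>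
  have rate: "a + 1 / (2 * a * (1 - \<epsilon>)) < sqrt 2 + \<delta>"
  proof -
    have "1 / (1 - \<epsilon>) \<le> 1 + 2 * \<epsilon>" using \<epsilon> by (simp add: field_simps)
    then have "a * (1 + 1 / (1 - \<epsilon>)) \<le> a * (2 + 2 * \<epsilon>)" using a by simp
    also have "\<dots> = sqrt 2 + sqrt 2 * \<epsilon>" by (simp add: a_def field_simps)
    also have "\<dots> < sqrt 2 + \<delta>"
    proof -
      have "sqrt 2 < 2" by (rule real_less_lsqrt) auto
      then have "sqrt 2 * \<epsilon> < 2 * \<epsilon>" using \<epsilon> by (intro mult_strict_right_mono) auto
      then show ?thesis using \<epsilon>(4) by linarith
    qed
    also have "a * (1 + 1 / (1 - \<epsilon>)) = a + a * (1 / (1 - \<epsilon>))"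
      by (simp only: distrib_left mult_1_right)
    also have "a * (1 / (1 - \<epsilon>)) = 1 / (2 * a) * (1 / (1 - \<epsilon>))"
      by (simp add: a_def real_div_sqrt)
    also have "\<dots> = 1 / (2 * a * (1 - \<epsilon>))" by simp
    finally show ?thesis .
  qed
  have "\<forall>\<^sub>F l in at_top.
      (ln 2 + a * sqrt (l * ln l) + B l * c + (B l + 1) * ln (B l + 1)) / sqrt (l * ln l) < sqrt 2 + \<delta>"
    using loss_asymptotics[of a "1 - \<epsilon>" c] a \<epsilon> rate unfolding B_def
    by (intro order_tendstoD(2)) auto
  then have ev_loss: "\<forall>\<^sub>F x in at_top.
      (ln 2 + a * s x + B (ln x) * c + (B (ln x) + 1) * ln (B (ln x) + 1)) / s x < sqrt 2 + \<delta>"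
    unfolding s_def by (rule eventually_compose_filterlim[OF _ ln_at_top])
  have D_lim: "filterlim D sequentially at_top"
  proof -
    have "filterlim (\<lambda>x. exp (a * s x)) at_top at_top"
      unfolding s_def using a by real_asymp
    then show ?thesis unfolding D_def
      by (intro filterlim_compose[OF filterlim_nat_sequentially] filterlim_compose[OF filterlim_floor_sequentially])
  qed
  have ev_window: "\<forall>\<^sub>F x in at_top.
     (\<Sum>d | d \<le> D x \<and> real d > real (D x) powr (1 - \<epsilon>). mangoldt d / real d) \<ge> \<epsilon> / 2 * ln (real (D x))"
    by (rule eventually_compose_filterlim[OF sum_mangoldt_div_window D_lim]) (use \<epsilon> in auto)
  have ev_D: "\<forall>\<^sub>F x in at_top. D x \<ge> 2"
    by (rule eventually_compose_filterlim[OF eventually_ge_at_top D_lim])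
  have ev_s: "\<forall>\<^sub>F x in at_top. a * s x > ln 2"
    unfolding s_def using a by real_asymp
  have ev_le: "\<forall>\<^sub>F x in at_top. exp (a * s x) \<le> x"
    unfolding s_def using a by real_asymp
  have ev_ln: "\<forall>\<^sub>F x :: real in at_top. ln x > 0"
    by real_asymp
  show ?thesis
    using ev_loss ev_window ev_D ev_s ev_le ev_ln
  proof eventually_elim
    case (elim x)
    have D_le: "real (D x) \<le> exp (a * s x)" unfolding D_def by simp
    have D_ge: "real (D x) \<ge> exp (a * s x) / 2"
      using elim(3) unfolding D_def by linarith
    have lnD_le: "ln (real (D x)) \<le> a * s x"
      using ln_le_cancel_iff[of "real (D x)" "exp (a * s x)"] D_le elim(3) by simp
    have lnD_ge: "ln (real (D x)) \<ge> a * s x - ln 2"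
    proof -
      have "a * s x - ln 2 = ln (exp (a * s x) / 2)" by (simp add: ln_divide_pos)
      also have "\<dots> \<le> ln (real (D x))" using D_ge by (intro ln_mono) auto
      finally show ?thesis .
    qed
    have lnD: "ln (real (D x)) > 0" using elim(3) by simp
    have x: "x > 0" using elim(5) by (meson exp_gt_zero less_le_trans)
    define j where "j = nat \<lceil>ln x / ((1 - \<epsilon>) * ln (real (D x)))\<rceil>"
    have j_ge: "real j \<ge> ln x / ((1 - \<epsilon>) * ln (real (D x)))"
      unfolding j_def by linarith
    have "real j \<le> ln x / ((1 - \<epsilon>) * ln (real (D x))) + 1"
      using elim(6) lnD \<epsilon> unfolding j_def by (simp add: less_imp_le)
    also have "\<dots> \<le> B (ln x)"
      using lnD_ge elim(4,6) lnD \<epsilon> unfolding B_def s_def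
      by (intro add_right_mono divide_left_mono mult_left_mono mult_pos_pos) auto
    finally have j_le: "real j \<le> B (ln x)" .

    have "x \<le> real (D x) * (real (D x) powr (1 - \<epsilon>)) ^ j"
    proof -
      have "ln x \<le> real j * ((1 - \<epsilon>) * ln (real (D x)))"
        using j_ge lnD \<epsilon> by (simp add: pos_divide_le_eq)
      also have "\<dots> = ln ((real (D x) powr (1 - \<epsilon>)) ^ j)"
        using elim(3) by (simp add: ln_realpow ln_powr)
      finally have "x \<le> (real (D x) powr (1 - \<epsilon>)) ^ j"
        using x elim(3) by (subst (asm) ln_le_cancel_iff) auto
      also have "\<dots> \<le> real (D x) * (real (D x) powr (1 - \<epsilon>)) ^ j"
        using elim(3) mult_right_mono[of 1 "real (D x)" "(real (D x) powr (1 - \<epsilon>)) ^ j"] by simp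
      finally show ?thesis .
    qed
    moreover have "x / real (D x) \<le> x / 1"
      using x elim(3) by (intro divide_left_mono) auto
    ultimately have X_le: "x / real (D x) \<le> real (D x) * (real (D x) powr (1 - \<epsilon>)) ^ j" by simp
    have X_ge: "1 \<le> x / real (D x)" using D_le elim(3,5) by simp
    define F where "F = x / real (D x) / 2 * ((\<epsilon> / 2) ^ j / fact (j + 1))"
    have "F \<le> real (smooth_count (x / real (D x)) (D x))"
      unfolding F_def using \<epsilon>(1,2) elim(3,2) X_ge X_le by (rule smooth_count_ge)
    also have "\<dots> \<le> real (f x)" using smooth_count_le_f[OF elim(3)] by simp
    finally have F_le: "F \<le> real (f x)" .
    have F_pos: "F > 0" unfolding F_def using x elim(3) \<epsilon> by simp
    have f_pos: "f x > 0" using F_le F_pos by linarith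

    have "ln (x / real (f x)) \<le> ln (x / F)"
      using F_le F_pos x f_pos by (intro ln_mono divide_left_mono) auto
    also have "x / F = 2 * real (D x) * (2 / \<epsilon>) ^ j * fact (j + 1)"
      using x elim(3) \<epsilon> unfolding F_def by (simp add: power_divide del: fact_Suc)
    also have "ln \<dots> = ln 2 + ln (real (D x)) + real j * c + ln (fact (j + 1))"
      using elim(3) \<epsilon> unfolding c_def
      by (simp add: ln_mult_pos ln_realpow del: fact_Suc)
    also have "ln (fact (j + 1) :: real) \<le> ln (real ((j + 1) ^ (j + 1)))"
      using fact_le_power[of "j + 1", where ?'a = real] by (intro ln_mono) auto
    also have "\<dots> = (real j + 1) * ln (real j + 1)"
      by (simp add: ln_realpow add.commute del: power_Suc)
    also have "\<dots> \<le> (B (ln x) + 1) * ln (B (ln x) + 1)"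
      using j_le by (intro mult_mono ln_mono) auto
    also have "ln 2 + ln (real (D x)) + real j * c + (B (ln x) + 1) * ln (B (ln x) + 1) \<le>
        ln 2 + a * s x + B (ln x) * c + (B (ln x) + 1) * ln (B (ln x) + 1)"
      using lnD_le j_le c by (intro add_mono mult_right_mono) auto
    also have "\<dots> < (sqrt 2 + \<delta>) * s x"
    proof -
      have "s x > 0" using elim(4) a by (smt (verit) ln_2_less_1 ln_gt_zero mult_nonneg_nonpos)
      then show ?thesis using elim(1) by (simp add: pos_divide_less_eq)
    qed
    finally show ?case using f_pos by (simp add: s_def)
  qed
qed

section \<open>From fixed margins to a single o(1) term\<close>

theorem mainTheorem3:
  shows "\<exists>\<epsilon> :: real \<Rightarrow> real. (\<epsilon> \<longlongrightarrow> 0) at_top \<and>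
           (\<forall>\<^sub>F x :: real in at_top. real (f x) > x / L (sqrt 2 + \<epsilon> x) x)"
proof (intro exI conjI)
  define s where "s x = sqrt (ln x * ln (ln x))" for x :: real
  \<comment> \<open>The \<open>max\<close> makes an upper bound on the loss suffice for convergence
    to 0, without any upper bound on \<open>f\<close>; the term \<open>1 / x\<close> makes the final
    inequality strict.\<close>
  define \<epsilon> where "\<epsilon> x = max 0 (ln (x / real (f x)) / s x - sqrt 2) + 1 / x" for x
  have s_pos: "\<forall>\<^sub>F x in at_top. s x > 0" unfolding s_def by real_asymp
  show "(\<epsilon> \<longlongrightarrow> 0) at_top"
  proof (rule tendstoI)
    fix e :: real assume "e > 0"
    then have "\<forall>\<^sub>F x in at_top. f x > 0 \<and> ln (x / real (f x)) < (sqrt 2 + e / 2) * s x"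
      unfolding s_def by (intro eventually_ln_div_f_less) simp
    moreover have "\<forall>\<^sub>F x :: real in at_top. 1 / x < e / 2" using \<open>e > 0\<close> by real_asymp
    ultimately show "\<forall>\<^sub>F x in at_top. dist (\<epsilon> x) 0 < e"
      using s_pos eventually_gt_at_top[of 0]
    proof eventually_elim
      case (elim x)
      then have "ln (x / real (f x)) / s x < sqrt 2 + e / 2"
        by (simp add: pos_divide_less_eq)
      moreover have "1 / x > 0" using elim by simp
      ultimately show ?case using elim(2) \<open>e > 0\<close> by (simp add: \<epsilon>_def dist_real_def)
    qed
  qed
  show "\<forall>\<^sub>F x :: real in at_top. real (f x) > x / L (sqrt 2 + \<epsilon> x) x"
    \<comment> \<open>This instance supplies \<open>f x > 0\<close>; the inequality itself is built
      into \<open>\<epsilon>\<close>.\<close>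
    using eventually_ln_div_f_less[OF zero_less_one] s_pos eventually_gt_at_top[of 0]
  proof eventually_elim
    case (elim x)
    have "1 / x > 0" using elim by simp
    then have "ln (x / real (f x)) / s x < sqrt 2 + \<epsilon> x" unfolding \<epsilon>_def by linarith
    then have "ln (x / real (f x)) < (sqrt 2 + \<epsilon> x) * s x"
      using elim by (simp add: pos_divide_less_eq)
    then have "exp (ln (x / real (f x))) < L (sqrt 2 + \<epsilon> x) x"
      by (simp add: L_def s_def)
    then have "x / real (f x) < L (sqrt 2 + \<epsilon> x) x"
      using elim by simp
    moreover have "L (sqrt 2 + \<epsilon> x) x > 0" by (simp add: L_def)
    ultimately show ?case using elim by (simp add: field_simps)
  qed
qed

end
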